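(* Let $n \ge 3$ be an integer, let $q \in (0,1]$, and let $\mathbf{u},\mathbf{v}\in\mathbb{R}^n$ be $0$-mean, unit-length vectors with Pearson correlation $r = \rho(\mathbf{u},\mathbf{v})$, where $0<|r|<1$. Let $\mathcal{T}^n$ be the set of $0$-mean, unit-length vectors in $\mathbb{R}^n$ whose correlation with $\mathbf{u}$ is $q$, and let $\widehat{\mathbf{u}}$ be a random vector sampled uniformly from $\mathcal{T}^n$. Put $c = |qr|/\sqrt{1-r^2}$ and $$h(n,q,r) = \begin{cases} \dfrac12\, \mathrm{I}[c^2 \le 1-q^2] & \text{if } n = 3,\\[2mm] \dfrac12 \displaystyle\int_0^\infty f_1(t)\, F_{n-3}\!\left(\frac{1-q^2-c^2}{c^2}\, t\right) dt & \text{if } n>3,\end{cases}$$ where $\mathrm{I}[\cdot]$ is the $0/1$ indicator function and $f_k$, $F_k$ are the PDF and CDF of a $\chi^2$ random variable with $k$ degrees of freedom. If $r<0$, then the probability of a false positive correlation is $\Pr[\rho(\widehat{\mathbf{u}},\mathbf{v}) \ge 0] = h(n,q,r)$. If $r>0$, then the probability of a false negative correlation is $\Pr[\rho(\widehat{\mathbf{u}},\mathbf{v}) < 0] = h(n,q,r)$.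
   Context: A vector in $\mathbb{R}^n$ is $0$-mean if its entries sum to $0$, and unit-length if its Euclidean norm is $1$. The Pearson product-moment correlation of two non-constant vectors $\mathbf{x},\mathbf{y}\in\mathbb{R}^n$ is $$\rho(\mathbf{x},\mathbf{y}) = \frac{(\mathbf{x}-\mu_{\mathbf{x}})^\top(\mathbf{y}-\mu_{\mathbf{y}})}{\|\mathbf{x}-\mu_{\mathbf{x}}\|_2\,\|\mathbf{y}-\mu_{\mathbf{y}}\|_2},$$ where $\mu_{\mathbf{x}}$ is the vector all of whose entries equal the mean of the entries of $\mathbf{x}$ (similarly $\mu_{\mathbf{y}}$). For $0$-mean unit-length vectors, $\rho(\mathbf{x},\mathbf{y})=\mathbf{x}^\top\mathbf{y}$. The set $\mathcal{T}^n$ is an $(n-3)$-sphere (of radius $\sqrt{1-q^2}$) lying in an $(n-2)$-dimensional affine subspace of $\mathbb{R}^n$. It is a single point if $q=1$, and two points if $n=3$ and $q<1$. "Sampled uniformly" means sampled from the unique probability measure on this sphere invariant under all orthogonal transformations of that affine subspace about the center of the sphere. The CDF $F_k$ is defined on all of $\mathbb{R}$, with $F_k(x)=0$ for $x\le 0$. A false positive correlation is the event $\rho(\widehat{\mathbf{u}},\mathbf{v})\ge 0$ when $r<0$. A false negative correlation is the event $\rho(\widehat{\mathbf{u}},\mathbf{v})<0$ when $r\ge 0$.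
   Formalization: The false-negative claim excludes the case n = 3 with c² = 1 − q² (i.e. q² + r² = 1), where it is false: the two points of T³ have correlations 0 and 2qr with v, so the probability is 0 while h = 1/2. *)

theory Defs
  imports "HOL-Probability.Probability"
begin

definition zero_mean :: "real ^ 'n \<Rightarrow> bool" where
  "zero_mean x \<longleftrightarrow> (\<Sum>i\<in>UNIV. x $ i) = 0"

definition mean_vec :: "real ^ 'n \<Rightarrow> real ^ 'n" where
  "mean_vec x = (\<chi> i. (\<Sum>j\<in>UNIV. x $ j) / real CARD('n))"

definition pearson :: "real ^ 'n \<Rightarrow> real ^ 'n \<Rightarrow> real" where
  "pearson x y =
     ((x - mean_vec x) \<bullet> (y - mean_vec y)) / (norm (x - mean_vec x) * norm (y - mean_vec y))"

definition corr_sphere :: "real ^ 'n \<Rightarrow> real \<Rightarrow> (real ^ 'n) set" where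
  "corr_sphere u q = {x. zero_mean x \<and> norm x = 1 \<and> pearson u x = q}"

(* For 0-mean unit-length u, corr_sphere u q is the sphere of radius sqrt (1 - q^2) about q *\<^sub>R u
   inside this affine subspace, which has dimension CARD('n) - 2. *)
definition corr_affine :: "real ^ 'n \<Rightarrow> real \<Rightarrow> (real ^ 'n) set" where
  "corr_affine u q = {x. zero_mean x \<and> u \<bullet> x = q}"

(* The law M is the uniform distribution on a sphere S with centre c lying in the affine
   subspace A.  An orthogonal transformation of A about c is given as the restriction to A of
   x \<mapsto> c + g (x - c), where g is an orthogonal transformation of the whole space that
   preserves the direction space of A; every orthogonal transformation of the direction space
   extends to such a g. *)
definition uniform_on_sphere ::
    "'a::euclidean_space set \<Rightarrow> 'a set \<Rightarrow> 'a \<Rightarrow> 'a measure \<Rightarrow> bool" where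
  "uniform_on_sphere S A c M \<longleftrightarrow>
     prob_space M \<and> sets M = sets borel \<and> emeasure M S = 1 \<and>
     (\<forall>g. orthogonal_transformation g \<and> (\<lambda>x. c + g (x - c)) ` A = A
        \<longrightarrow> distr M borel (\<lambda>x. c + g (x - c)) = M)"

definition chi_square_density :: "nat \<Rightarrow> real \<Rightarrow> real" where
  "chi_square_density k x =
     (if x > 0
      then x powr (real k / 2 - 1) * exp (- x / 2) / (2 powr (real k / 2) * Gamma (real k / 2))
      else 0)"

definition chi_square_cdf :: "nat \<Rightarrow> real \<Rightarrow> real" where
  "chi_square_cdf k = cdf (density lborel (\<lambda>x. ennreal (chi_square_density k x)))"

definition corr_ratio :: "real \<Rightarrow> real \<Rightarrow> real" where
  "corr_ratio q r = \<bar>q * r\<bar> / sqrt (1 - r\<^sup>2)"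

definition h :: "nat \<Rightarrow> real \<Rightarrow> real \<Rightarrow> real" where
  "h n q r =
     (let c = corr_ratio q r in
      if n = 3 then (if c\<^sup>2 \<le> 1 - q\<^sup>2 then 1 / 2 else 0)
      else 1 / 2 * (LINT t:{0..}|lborel.
             chi_square_density 1 t * chi_square_cdf (n - 3) ((1 - q\<^sup>2 - c\<^sup>2) / c\<^sup>2 * t)))"

(* Boundary case n = 3, r > 0, (corr_ratio q r)^2 = 1 - q^2 (i.e. q^2 + r^2 = 1): the two points of
   corr_sphere u q have correlations 0 and 2 * q * r with v, so the probability of a strictly
   negative correlation is 0 although h 3 q r = 1/2.  The false-negative formula fails exactly
   there; the false-positive formula (non-strict inequality, r < 0) has no such exception. *)

end

theory Submission
  imports Defs
begin

text \<open>
  Decompose \<open>v = r u + sqrt (1 - r\<^sup>2) e\<close> with \<open>e\<close> a unit vector orthogonal to \<open>u\<close> and to the constant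
  vector. On the sphere, the sign of the correlation with \<open>v\<close> is decided by comparing \<open>x \<bullet> e\<close> with
  \<open>\<plusminus>c\<close>, where \<open>c = corr_ratio q r\<close>. With \<open>W\<close> the orthogonal complement of \<open>u\<close> and the constant vector,
  the law of \<open>x \<bullet> e\<close> is that of \<open>s (g \<bullet> e) / norm (P\<^sub>W g)\<close> for a standard Gaussian \<open>g\<close> and
  \<open>s = sqrt (1 - q\<^sup>2)\<close>. Since \<open>norm (P\<^sub>W g)\<^sup>2 = (g \<bullet> e)\<^sup>2 + Y\<close> with \<open>(g \<bullet> e)\<^sup>2\<close> and \<open>Y\<close> independent
  chi-square variables with \<open>1\<close> and \<open>n - 3\<close> degrees of freedom, the event \<open>c \<le> \<bar>x \<bullet> e\<bar>\<close> becomes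
  \<open>Y \<le> ((s\<^sup>2 - c\<^sup>2) / c\<^sup>2) (g \<bullet> e)\<^sup>2\<close>; the factor \<open>1 / 2\<close> comes from the reflection \<open>e \<mapsto> - e\<close>.
  For \<open>n = 3\<close> the space \<open>W\<close> is a line and \<open>\<bar>x \<bullet> e\<bar> = s\<close> almost surely.
\<close>

subsection \<open>Orthogonal invariance of Lebesgue measure\<close>

text \<open>The image measure is translation invariant, hence by Fubini proportional to \<open>lborel\<close>, and both
  measures agree on the unit ball.\<close>

lemma lborel_distr_orthogonal:
  fixes T :: "'a::euclidean_space \<Rightarrow> 'a"
  assumes T: "orthogonal_transformation T"
  shows "distr lborel borel T = lborel"
proof (rule measure_eqI)
  let ?M = "distr lborel borel T"
  have [measurable]: "T \<in> borel_measurable borel"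
    using T by (intro borel_measurable_continuous_onI linear_continuous_on)
      (simp add: orthogonal_transformation_linear linear_conv_bounded_linear[symmetric])
  have lin: "linear T" and bijT: "bij T"
    using T by (auto simp: orthogonal_transformation_linear orthogonal_transformation_bij)
  have vim_ball: "T -` ball 0 r = ball 0 r" for r :: real
    using T by (auto simp: orthogonal_transformation_norm)
  have ball: "emeasure ?M (ball 0 r) = emeasure lborel (ball (0::'a) r)" for r
    by (subst emeasure_distr) (auto simp: vim_ball)
  interpret M: sigma_finite_measure ?M
  proof
    show "\<exists>A. countable A \<and> A \<subseteq> sets ?M \<and> \<Union> A = space ?M \<and> (\<forall>a\<in>A. emeasure ?M a \<noteq> \<infinity>)"
    proof (intro exI conjI ballI)
      show "countable (range (\<lambda>n::nat. ball (0::'a) (real n)))" by simp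
      show "range (\<lambda>n::nat. ball (0::'a) (real n)) \<subseteq> sets ?M" by auto
      show "\<Union> (range (\<lambda>n::nat. ball (0::'a) (real n))) = space ?M"
        by (auto simp: reals_Archimedean2)
      fix a assume "a \<in> range (\<lambda>n::nat. ball (0::'a) (real n))"
      then show "emeasure ?M a \<noteq> \<infinity>"
        using emeasure_bounded_finite[of "ball (0::'a) _"] by (auto simp: ball less_top)
    qed
  qed
  interpret P: pair_sigma_finite lborel ?M ..
  have trans: "distr ?M borel (\<lambda>x. x + y) = ?M" for y
  proof -
    obtain z where z: "y = T z" using bijT by (metis bij_pointE)
    have "distr ?M borel (\<lambda>x. x + y) = distr lborel borel (\<lambda>x. T (z + x))"
      by (subst distr_distr) (auto simp: comp_def z linear_add[OF lin] add.commute)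
    also have "\<dots> = distr (distr lborel borel ((+) z)) borel T"
      by (subst distr_distr) (auto simp: comp_def)
    finally show ?thesis by (simp add: lborel_distr_plus)
  qed
  have key: "emeasure ?M A * emeasure lborel B = emeasure ?M B * emeasure lborel A"
    if [measurable]: "A \<in> sets borel" "B \<in> sets borel" for A B :: "'a set"
  proof -
    have "emeasure ?M A * emeasure lborel B
        = (\<integral>\<^sup>+x. \<integral>\<^sup>+y. indicator A x * indicator B y \<partial>lborel \<partial>?M)"
      by (simp add: nn_integral_cmult nn_integral_multc)
    also have "\<dots> = (\<integral>\<^sup>+x. \<integral>\<^sup>+y. indicator A x * indicator B y \<partial>distr lborel borel ((+) x) \<partial>?M)"
      by (simp add: lborel_distr_plus)
    also have "\<dots> = (\<integral>\<^sup>+x. \<integral>\<^sup>+y. indicator A x * indicator B (x + y) \<partial>lborel \<partial>?M)"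
      by (simp add: nn_integral_distr)
    also have "\<dots> = (\<integral>\<^sup>+y. \<integral>\<^sup>+x. indicator A x * indicator B (x + y) \<partial>?M \<partial>lborel)"
      by (intro P.Fubini') simp
    also have "\<dots> = (\<integral>\<^sup>+y. \<integral>\<^sup>+x. indicator A (x - y) * indicator B x \<partial>distr ?M borel (\<lambda>x. x + y) \<partial>lborel)"
      by (subst nn_integral_distr) auto
    also have "\<dots> = (\<integral>\<^sup>+y. \<integral>\<^sup>+x. indicator A (x - y) * indicator B x \<partial>?M \<partial>lborel)"
      by (simp only: trans)
    also have "\<dots> = (\<integral>\<^sup>+x. \<integral>\<^sup>+y. indicator A (x - y) * indicator B x \<partial>lborel \<partial>?M)"
      by (intro P.Fubini'[symmetric]) simp
    also have "\<dots> = (\<integral>\<^sup>+x. emeasure lborel A * indicator B x \<partial>?M)"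
    proof (intro nn_integral_cong)
      fix x
      have "(\<integral>\<^sup>+y. indicator A (x - y) * indicator B x \<partial>lborel)
          = (\<integral>\<^sup>+y. indicator A (x - y) \<partial>lborel) * indicator B x"
        by (rule nn_integral_multc) simp
      also have "(\<integral>\<^sup>+y. indicator A (x - y) \<partial>lborel) = (\<integral>\<^sup>+y. indicator A y \<partial>distr lborel borel (\<lambda>y. x - y))"
        by (subst nn_integral_distr) auto
      also have "distr lborel borel (\<lambda>y. x - y) = lborel"
        using lborel_affine[of "-1" x] by (simp add: density_1)
      finally show "(\<integral>\<^sup>+y. indicator A (x - y) * indicator B x \<partial>lborel) = emeasure lborel A * indicator B x"
        by simp
    qed
    also have "\<dots> = emeasure ?M B * emeasure lborel A"
      by (subst nn_integral_cmult) (auto simp: mult.commute)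
    finally show ?thesis .
  qed
  fix A assume "A \<in> sets ?M"
  then have A: "A \<in> sets borel" by simp
  let ?l = "emeasure lborel (ball (0::'a) 1)"
  have "?l < \<infinity>" using emeasure_bounded_finite[of "ball (0::'a) 1"] by simp
  moreover have "?l \<noteq> 0"
    using content_ball_pos[of 1 "0::'a"] by (auto simp: measure_def)
  ultimately show "emeasure ?M A = emeasure lborel A"
    using key[OF A, of "ball 0 1"]
    by (simp add: ball) (metis ennreal_mult_cancel_left ennreal_mult_eq_top_iff infinity_ennreal_def less_irrefl mult.commute)
qed simp

subsection \<open>Standard Gaussian vectors\<close>

definition std_gauss :: "'a::euclidean_space measure" where
  "std_gauss = density lborel (\<lambda>x. ennreal (\<Prod>b\<in>Basis. std_normal_density (x \<bullet> b)))"

abbreviation std_normal :: "real measure" where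
  "std_normal \<equiv> density lborel (\<lambda>x. ennreal (std_normal_density x))"

lemma space_std_gauss [simp]: "space std_gauss = UNIV"
  and sets_std_gauss [simp, measurable_cong]: "sets std_gauss = sets borel"
  by (simp_all add: std_gauss_def)

lemma orthogonal_transformation_measurable:
  fixes T :: "'a::euclidean_space \<Rightarrow> 'a"
  shows "orthogonal_transformation T \<Longrightarrow> T \<in> borel_measurable borel"
  by (intro borel_measurable_continuous_onI linear_continuous_on)
    (simp add: orthogonal_transformation_linear linear_conv_bounded_linear[symmetric])

lemma distr_std_gauss_orthogonal:
  fixes T :: "'a::euclidean_space \<Rightarrow> 'a"
  assumes T: "orthogonal_transformation T"
  shows "distr std_gauss borel T = std_gauss"
proof -
  note [measurable] = orthogonal_transformation_measurable[OF T]
  have prod_norm: "(\<Prod>b\<in>Basis. std_normal_density (x \<bullet> b))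
      = (1 / sqrt (2 * pi)) ^ DIM('a) * exp (- (norm x)\<^sup>2 / 2)" for x :: 'a
  proof -
    have "(norm x)\<^sup>2 = (\<Sum>b\<in>Basis. (x \<bullet> b)\<^sup>2)"
      unfolding power2_norm_eq_inner by (subst euclidean_inner) (simp add: power2_eq_square)
    then have "exp (- (norm x)\<^sup>2 / 2) = (\<Prod>b\<in>Basis. exp (- (x \<bullet> b)\<^sup>2 / 2))"
      by (simp add: exp_sum[symmetric] sum_negf sum_divide_distrib)
    then show ?thesis
      by (simp add: std_normal_density_def prod_dividef prod.distrib power_divide)
  qed
  have "std_gauss = density (distr lborel borel T)
      (\<lambda>x. ennreal (\<Prod>b\<in>Basis. std_normal_density (x \<bullet> b)))"
    by (simp add: std_gauss_def lborel_distr_orthogonal[OF T])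
  also have "\<dots> = distr (density lborel (\<lambda>x. ennreal (\<Prod>b\<in>Basis. std_normal_density (T x \<bullet> b)))) borel T"
    by (intro density_distr) simp_all
  also have "\<dots> = distr std_gauss borel T"
    using T by (simp add: std_gauss_def prod_norm orthogonal_transformation_norm)
  finally show ?thesis ..
qed

lemma emeasure_std_gauss_box:
  fixes A :: "'a::euclidean_space \<Rightarrow> real set"
  assumes A: "\<And>b. b \<in> Basis \<Longrightarrow> A b \<in> sets borel"
  shows "emeasure std_gauss {x. \<forall>b\<in>Basis. x \<bullet> b \<in> A b} = (\<Prod>b\<in>Basis. emeasure std_normal (A b))"
proof -
  have [measurable]: "{x::'a. \<forall>b\<in>Basis. x \<bullet> b \<in> A b} \<in> sets borel"
    using A by measurable
  have [measurable]: "b \<in> Basis \<Longrightarrow> A b \<in> sets borel" for b using A .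
  have "emeasure std_gauss {x. \<forall>b\<in>Basis. x \<bullet> b \<in> A b}
      = (\<integral>\<^sup>+x. ennreal (\<Prod>b\<in>Basis. std_normal_density (x \<bullet> b))
          * indicator {x. \<forall>b\<in>Basis. x \<bullet> b \<in> A b} x \<partial>lborel)"
    by (simp add: std_gauss_def emeasure_density)
  also have "\<dots> = (\<integral>\<^sup>+x. (\<Prod>b\<in>Basis. ennreal (std_normal_density (x \<bullet> b)) * indicator (A b) (x \<bullet> b)) \<partial>lborel)"
    by (intro nn_integral_cong)
      (auto simp: indicator_def prod_ennreal prod.distrib prod_zero_iff)
  also have "\<dots> = (\<Prod>b\<in>Basis. (\<integral>\<^sup>+x. ennreal (std_normal_density x) * indicator (A b) x \<partial>lborel))"
    by (rule nn_integral_lborel_prod) auto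
  also have "\<dots> = (\<Prod>b\<in>Basis. emeasure std_normal (A b))"
    by (intro prod.cong refl) (simp add: emeasure_density)
  finally show ?thesis .
qed

lemma prob_space_std_normal: "prob_space std_normal"
  by (rule prob_space_normal_density) simp

lemma prob_space_std_gauss: "prob_space (std_gauss :: 'a::euclidean_space measure)"
proof
  have "emeasure (std_gauss :: 'a measure) (space std_gauss) = (\<Prod>b\<in>(Basis::'a set). emeasure std_normal UNIV)"
    using emeasure_std_gauss_box[of "\<lambda>_::'a. UNIV"] by simp
  then show "emeasure (std_gauss :: 'a measure) (space std_gauss) = 1"
    using prob_space.emeasure_space_1[OF prob_space_std_normal] by simp
qed

lemma orthonormal_basis_isometry:
  fixes B :: "'a::euclidean_space set"
  assumes B: "finite B" "card B = DIM('a)" "\<And>b. b \<in> B \<Longrightarrow> norm b = 1" "pairwise orthogonal B"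
  obtains T :: "'a \<Rightarrow> 'a" and p where "orthogonal_transformation T" "bij_betw p Basis B"
    "\<And>x i. i \<in> Basis \<Longrightarrow> T x \<bullet> p i = x \<bullet> i"
proof -
  obtain p where p: "bij_betw p (Basis :: 'a set) B"
    using B finite_same_card_bij[of "Basis :: 'a set" B] by auto
  have orth: "p i \<bullet> p j = (if i = j then 1 else 0)" if "i \<in> Basis" "j \<in> Basis" for i j
    using that p B(3)[of "p i"] pairwiseD[OF B(4), of "p i" "p j"]
    by (auto simp: bij_betw_def inj_on_eq_iff orthogonal_def norm_eq_1)
  define T where "T x = (\<Sum>i\<in>Basis. (x \<bullet> i) *\<^sub>R p i)" for x
  have T: "T x \<bullet> p i = x \<bullet> i" if "i \<in> Basis" for x i
    using that by (simp add: T_def inner_sum_left orth if_distrib cong: if_cong)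
  have "linear T"
    unfolding T_def by (rule linearI) (simp_all add: inner_add_left scaleR_add_left sum.distrib scaleR_sum_right)
  moreover have "T x \<bullet> T y = x \<bullet> y" for x y
    unfolding T_def[of y] by (simp add: inner_sum_right T euclidean_inner[of x y] mult.commute)
  ultimately show thesis
    by (intro that[of T p] p T) (auto simp: orthogonal_transformation_def)
qed

lemma sum_inner_orthonormal_basis:
  fixes B :: "'a::euclidean_space set"
  assumes B: "finite B" "card B = DIM('a)" "\<And>b. b \<in> B \<Longrightarrow> norm b = 1" "pairwise orthogonal B"
  shows "(\<Sum>b\<in>B. (x \<bullet> b)\<^sup>2) = (norm x)\<^sup>2"
proof -
  obtain T :: "'a \<Rightarrow> 'a" and p where T: "orthogonal_transformation T" and p: "bij_betw p Basis B"
    and Tp: "\<And>x i. i \<in> Basis \<Longrightarrow> T x \<bullet> p i = x \<bullet> i"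
    using orthonormal_basis_isometry[OF B] by blast
  obtain z where z: "x = T z" using orthogonal_transformation_bij[OF T] by (metis bij_pointE)
  have "(\<Sum>b\<in>B. (x \<bullet> b)\<^sup>2) = (\<Sum>i\<in>Basis. (T z \<bullet> p i)\<^sup>2)"
    unfolding z by (rule sum.reindex_bij_betw[OF p, symmetric])
  also have "\<dots> = (norm z)\<^sup>2"
    unfolding power2_norm_eq_inner by (subst euclidean_inner) (simp add: Tp power2_eq_square)
  finally show ?thesis using T by (simp add: z orthogonal_transformation_norm)
qed

lemma emeasure_std_gauss_orthonormal_box:
  fixes B :: "'a::euclidean_space set"
  assumes B: "finite B" "card B = DIM('a)" "\<And>b. b \<in> B \<Longrightarrow> norm b = 1" "pairwise orthogonal B"
    and A: "\<And>b. b \<in> B \<Longrightarrow> A b \<in> sets borel"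
  shows "emeasure std_gauss {x. \<forall>b\<in>B. x \<bullet> b \<in> A b} = (\<Prod>b\<in>B. emeasure std_normal (A b))"
proof -
  obtain T :: "'a \<Rightarrow> 'a" and p where T: "orthogonal_transformation T" and p: "bij_betw p Basis B"
    and Tp: "\<And>x i. i \<in> Basis \<Longrightarrow> T x \<bullet> p i = x \<bullet> i"
    using orthonormal_basis_isometry[OF B] by blast
  have [measurable]: "T \<in> borel_measurable borel" by (rule orthogonal_transformation_measurable[OF T])
  have [measurable]: "{x::'a. \<forall>b\<in>B. x \<bullet> b \<in> A b} \<in> sets borel"
    using A B(1) by measurable
  have "emeasure std_gauss {x. \<forall>b\<in>B. x \<bullet> b \<in> A b}
      = emeasure (distr std_gauss borel T) {x. \<forall>b\<in>B. x \<bullet> b \<in> A b}"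
    by (simp add: distr_std_gauss_orthogonal[OF T])
  also have "\<dots> = emeasure std_gauss {x. \<forall>b\<in>B. T x \<bullet> b \<in> A b}"
    by (subst emeasure_distr) (auto simp: vimage_def)
  also have "{x. \<forall>b\<in>B. T x \<bullet> b \<in> A b} = {x. \<forall>i\<in>Basis. x \<bullet> i \<in> A (p i)}"
    using p by (auto simp: bij_betw_def Tp)
  also have "emeasure std_gauss \<dots> = (\<Prod>i\<in>Basis. emeasure std_normal (A (p i)))"
    using A p by (intro emeasure_std_gauss_box) (auto simp: bij_betw_def)
  also have "\<dots> = (\<Prod>b\<in>B. emeasure std_normal (A b))"
    by (rule prod.reindex_bij_betw[OF p])
  finally show ?thesis .
qed

lemma std_gauss_coordinate:
  fixes B :: "'a::euclidean_space set"
  assumes B: "finite B" "card B = DIM('a)" "\<And>b. b \<in> B \<Longrightarrow> norm b = 1" "pairwise orthogonal B"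
    and "b \<in> B"
  shows "distr std_gauss borel (\<lambda>x. x \<bullet> b) = std_normal"
proof (rule measure_eqI)
  fix S assume "S \<in> sets (distr std_gauss borel (\<lambda>x. x \<bullet> b))"
  then have S: "S \<in> sets borel" by simp
  have one: "emeasure std_normal UNIV = 1"
    using prob_space.emeasure_space_1[OF prob_space_std_normal] by simp
  have "emeasure (distr std_gauss borel (\<lambda>x. x \<bullet> b)) S
      = emeasure std_gauss {x. \<forall>b'\<in>B. x \<bullet> b' \<in> (if b' = b then S else UNIV)}"
    using S \<open>b \<in> B\<close> by (subst emeasure_distr) (auto intro!: arg_cong[where f = "emeasure std_gauss"] split: if_splits)
  also have "\<dots> = (\<Prod>b'\<in>B. emeasure std_normal (if b' = b then S else UNIV))"
    using S by (intro emeasure_std_gauss_orthonormal_box B) auto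
  also have "\<dots> = (\<Prod>b'\<in>B. if b' = b then emeasure std_normal S else 1)"
    by (intro prod.cong) (simp_all add: one)
  also have "\<dots> = emeasure std_normal S"
    using B(1) \<open>b \<in> B\<close> by simp
  finally show "emeasure (distr std_gauss borel (\<lambda>x. x \<bullet> b)) S = emeasure std_normal S" .
qed simp

lemma indep_vars_std_gauss:
  fixes B :: "'a::euclidean_space set"
  assumes B: "finite B" "card B = DIM('a)" "\<And>b. b \<in> B \<Longrightarrow> norm b = 1" "pairwise orthogonal B"
  shows "prob_space.indep_vars std_gauss (\<lambda>_. borel) (\<lambda>b x. x \<bullet> b) B"
proof -
  interpret prob_space "std_gauss :: 'a measure" by (rule prob_space_std_gauss)
  interpret N: prob_space std_normal by (rule prob_space_std_normal)
  interpret product_sigma_finite "\<lambda>_::'a. std_normal" ..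
  have "B \<noteq> {}" using B(2) by auto
  have "distr std_gauss (\<Pi>\<^sub>M b\<in>B. borel) (\<lambda>x. \<lambda>b\<in>B. x \<bullet> b) = (\<Pi>\<^sub>M b\<in>B. std_normal)"
  proof (rule PiM_eqI)
    show "sets (distr std_gauss (\<Pi>\<^sub>M b\<in>B. borel) (\<lambda>x. \<lambda>b\<in>B. x \<bullet> b)) = sets (\<Pi>\<^sub>M b\<in>B. std_normal)"
      by (auto intro!: sets_PiM_cong)
    fix A :: "'a \<Rightarrow> real set" assume "\<And>b. b \<in> B \<Longrightarrow> A b \<in> sets std_normal"
    then have A: "\<And>b. b \<in> B \<Longrightarrow> A b \<in> sets borel" by simp
    have "emeasure (distr std_gauss (\<Pi>\<^sub>M b\<in>B. borel) (\<lambda>x. \<lambda>b\<in>B. x \<bullet> b)) (Pi\<^sub>E B A)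
        = emeasure std_gauss {x. \<forall>b\<in>B. x \<bullet> b \<in> A b}"
      using A B(1) by (subst emeasure_distr)
        (auto intro!: sets_PiM_I_finite arg_cong[where f = "emeasure std_gauss"])
    then show "emeasure (distr std_gauss (\<Pi>\<^sub>M b\<in>B. borel) (\<lambda>x. \<lambda>b\<in>B. x \<bullet> b)) (Pi\<^sub>E B A)
        = (\<Prod>b\<in>B. emeasure std_normal (A b))"
      using emeasure_std_gauss_orthonormal_box[OF B A] by simp
  qed (fact B(1))
  then show ?thesis
    using \<open>B \<noteq> {}\<close> by (subst indep_vars_iff_distr_eq_PiM')
      (auto simp: std_gauss_coordinate[OF B] intro!: PiM_cong)
qed

subsection \<open>Chi-square distributions\<close>

lemma nn_integral_square_substitution:
  fixes f :: "real \<Rightarrow> ennreal"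
  assumes [measurable]: "f \<in> borel_measurable borel"
  shows "(\<integral>\<^sup>+x. f x * indicator {0..} x \<partial>lborel) = (\<integral>\<^sup>+x. f (x\<^sup>2) * ennreal (2 * x) * indicator {0..} x \<partial>lborel)"
proof -
  have sup: "(\<integral>\<^sup>+x. g x * indicator {0..} x \<partial>lborel) = (SUP n. \<integral>\<^sup>+x. g x * indicator {0..a n} x \<partial>lborel)"
    if [measurable]: "g \<in> borel_measurable borel" and a: "incseq a" "\<And>x. \<exists>n. x \<le> a n"
    for g :: "real \<Rightarrow> ennreal" and a :: "nat \<Rightarrow> real"
  proof -
    have "g x * indicator {0..} x = (SUP n. g x * indicator {0..a n} x)" for x
    proof (rule antisym)
      obtain n where "x \<le> a n" using a(2) by blast
      then have "g x * indicator {0..} x = g x * indicator {0..a n} x" by (auto split: split_indicator)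
      then show "g x * indicator {0..} x \<le> (SUP n. g x * indicator {0..a n} x)"
        by (intro SUP_upper2[of n]) auto
      show "(SUP n. g x * indicator {0..a n} x) \<le> g x * indicator {0..} x"
        by (intro SUP_least) (auto split: split_indicator)
    qed
    moreover have "incseq (\<lambda>n x. g x * indicator {0..a n} x)"
      using a(1) by (auto simp: mono_def le_fun_def split: split_indicator) (meson order_trans)
    ultimately show ?thesis
      by (simp add: nn_integral_monotone_convergence_SUP)
  qed
  have "(\<integral>\<^sup>+x. f x * indicator {0..(real (Suc n))\<^sup>2} x \<partial>lborel)
      = (\<integral>\<^sup>+x. f (x\<^sup>2) * ennreal (2 * x) * indicator {0..real (Suc n)} x \<partial>lborel)" for n
  proof -
    have "((\<lambda>x. x\<^sup>2) has_real_derivative 2 * x) (at x)" for x :: real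
      by (auto intro!: derivative_eq_intros)
    then show ?thesis
      using nn_integral_substitution_aux[of f 0 "real (Suc n)" "\<lambda>x. x\<^sup>2" "\<lambda>x. 2 * x"]
      by (simp add: continuous_on_mult_left del: of_nat_Suc)
  qed
  moreover have "\<exists>n. x \<le> real (Suc n)" "\<exists>n. x \<le> (real (Suc n))\<^sup>2" for x
  proof -
    obtain n where n: "x \<le> real n" using real_arch_simple by blast
    then show "\<exists>n. x \<le> real (Suc n)" by (intro exI[of _ n]) simp
    have "real n \<le> (real (Suc n))\<^sup>2" by (simp add: power2_eq_square algebra_simps)
    then show "\<exists>n. x \<le> (real (Suc n))\<^sup>2" using n by (intro exI[of _ n]) linarith
  qed
  ultimately show ?thesis
    by (subst (1 2) sup[where a = "\<lambda>n. (real (Suc n))\<^sup>2"] sup[where a = "\<lambda>n. real (Suc n)"])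
      (auto simp: mono_def intro!: power_mono)
qed

lemma chi_square_density_measurable [measurable]: "chi_square_density k \<in> borel_measurable borel"
  unfolding chi_square_density_def[abs_def] by measurable

lemma chi_square_density_nonneg: "0 \<le> chi_square_density k x"
  by (cases k) (auto simp: chi_square_density_def Gamma_real_pos intro!: mult_nonneg_nonneg divide_nonneg_nonneg less_imp_le[OF Gamma_real_pos])

lemma distr_std_normal_square:
  "distr std_normal borel (\<lambda>z. z\<^sup>2) = density lborel (\<lambda>x. ennreal (chi_square_density 1 x))"
proof (rule measure_eqI)
  fix S assume "S \<in> sets (distr std_normal borel (\<lambda>z. z\<^sup>2))"
  then have [measurable]: "S \<in> sets borel" by simp
  let ?g = "\<lambda>z. ennreal (std_normal_density z) * indicator S (z\<^sup>2) :: ennreal"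
  have chi: "chi_square_density 1 (z\<^sup>2) * (2 * z) = 2 * std_normal_density z" if "0 < z" for z
    using that
    by (simp add: chi_square_density_def std_normal_density_def Gamma_one_half_real powr_minus
        powr_half_sqrt real_sqrt_mult field_simps)
  have "emeasure (distr std_normal borel (\<lambda>z. z\<^sup>2)) S = emeasure std_normal ((\<lambda>z. z\<^sup>2) -` S)"
    by (simp add: emeasure_distr)
  also have "\<dots> = (\<integral>\<^sup>+z. ?g z \<partial>lborel)"
    by (subst emeasure_density) (auto intro!: nn_integral_cong measurable_sets_borel[of _ borel] split: split_indicator)
  also have "\<dots> = (\<integral>\<^sup>+z. ?g z * indicator {0<..} z + ?g z * indicator {..<0} z \<partial>lborel)"
    by (intro nn_integral_cong_AE) (use AE_lborel_singleton[of 0] in eventually_elim, auto split: split_indicator)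
  also have "\<dots> = (\<integral>\<^sup>+z. ?g z * indicator {0<..} z \<partial>lborel) + (\<integral>\<^sup>+z. ?g z * indicator {..<0} z \<partial>lborel)"
    by (intro nn_integral_add) auto
  also have "(\<integral>\<^sup>+z. ?g z * indicator {..<0} z \<partial>lborel) = (\<integral>\<^sup>+z. ?g z * indicator {..<0} z \<partial>distr lborel borel uminus)"
    by (simp add: lborel_distr_uminus)
  also have "\<dots> = (\<integral>\<^sup>+z. ?g z * indicator {0<..} z \<partial>lborel)"
    by (subst nn_integral_distr) (auto simp: std_normal_density_def indicator_def intro!: nn_integral_cong)
  also have "(\<integral>\<^sup>+z. ?g z * indicator {0<..} z \<partial>lborel) + (\<integral>\<^sup>+z. ?g z * indicator {0<..} z \<partial>lborel)
      = 2 * (\<integral>\<^sup>+z. ?g z * indicator {0<..} z \<partial>lborel)"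
    by (rule mult_2[symmetric])
  also have "\<dots> = (\<integral>\<^sup>+z. 2 * (?g z * indicator {0<..} z) \<partial>lborel)"
    by (simp add: nn_integral_cmult)
  also have "\<dots> = (\<integral>\<^sup>+z. (ennreal (chi_square_density 1 (z\<^sup>2)) * indicator S (z\<^sup>2)) * ennreal (2 * z) * indicator {0..} z \<partial>lborel)"
  proof (intro nn_integral_cong_AE, use AE_lborel_singleton[of 0] in eventually_elim)
    fix z :: real assume "z \<noteq> 0"
    show "2 * (?g z * indicator {0<..} z)
        = (ennreal (chi_square_density 1 (z\<^sup>2)) * indicator S (z\<^sup>2)) * ennreal (2 * z) * indicator {0..} z"
    proof (cases "0 < z")
      case True
      have "ennreal (chi_square_density 1 (z\<^sup>2)) * ennreal (2 * z)
          = ennreal (chi_square_density 1 (z\<^sup>2) * (2 * z))"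
        using True by (intro ennreal_mult[symmetric] chi_square_density_nonneg) simp
      also have "\<dots> = 2 * ennreal (std_normal_density z)"
        unfolding chi[OF True] by (simp add: ennreal_mult)
      finally have "ennreal (chi_square_density 1 (z\<^sup>2)) * ennreal (2 * z)
          = 2 * ennreal (std_normal_density z)" .
      then show ?thesis using True by (auto split: split_indicator)
    qed (use \<open>z \<noteq> 0\<close> in auto)
  qed
  also have "\<dots> = (\<integral>\<^sup>+x. (ennreal (chi_square_density 1 x) * indicator S x) * indicator {0..} x \<partial>lborel)"
    by (intro nn_integral_square_substitution[symmetric]) simp
  also have "\<dots> = (\<integral>\<^sup>+x. ennreal (chi_square_density 1 x) * indicator S x \<partial>lborel)"
    by (intro nn_integral_cong) (auto simp: chi_square_density_def split: split_indicator)
  also have "\<dots> = emeasure (density lborel (\<lambda>x. ennreal (chi_square_density 1 x))) S"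
    by (simp add: emeasure_density)
  finally show "emeasure (distr std_normal borel (\<lambda>z. z\<^sup>2)) S
      = emeasure (density lborel (\<lambda>x. ennreal (chi_square_density 1 x))) S" .
qed simp

lemma chi_square_density_convolution:
  assumes "0 < k" "0 < m"
  shows "(\<integral>\<^sup>+y. ennreal (chi_square_density k (x - y)) * ennreal (chi_square_density m y) \<partial>lborel)
      = ennreal (chi_square_density (k + m) x)"
proof (cases "0 < x")
  case False
  then have "ennreal (chi_square_density k (x - y)) * ennreal (chi_square_density m y) = 0" for y
    by (auto simp: chi_square_density_def)
  then have "(\<integral>\<^sup>+y. ennreal (chi_square_density k (x - y)) * ennreal (chi_square_density m y) \<partial>lborel) = 0"
    by (simp only: nn_integral_const mult_zero_left)
  then show ?thesis using False by (simp add: chi_square_density_def)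
next
  case True
  define a b where "a = real k / 2" and "b = real m / 2"
  have ab: "0 < a" "0 < b" using assms by (auto simp: a_def b_def)
  define C where "C = x powr (a + b - 2) * exp (- x / 2) / (2 powr (a + b) * Gamma a * Gamma b)"
  have C: "0 \<le> C" using ab by (auto simp: C_def Gamma_real_pos less_imp_le)
  have pt: "chi_square_density k (x - x * t) * chi_square_density m (x * t)
      = C * (t powr (b - 1) * (1 - t) powr (a - 1))" if "0 < t" "t < 1" for t
  proof -
    have *: "x - x * t = x * (1 - t)" by (simp add: algebra_simps)
    have "x powr (a + b - 2) = x powr (a - 1) * x powr (b - 1)"
      by (simp add: powr_add[symmetric])
    moreover have "exp (- x / 2) = exp (- (x * (1 - t)) / 2) * exp (- (x * t) / 2)"
      by (simp add: exp_add[symmetric] algebra_simps diff_divide_distrib add_divide_distrib)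
    ultimately show ?thesis using that True ab unfolding * C_def
      by (simp add: chi_square_density_def a_def[symmetric] b_def[symmetric] powr_mult powr_add mult_ac)
  qed
  have "(\<integral>\<^sup>+y. ennreal (chi_square_density k (x - y)) * ennreal (chi_square_density m y) \<partial>lborel)
      = \<bar>x\<bar> * (\<integral>\<^sup>+t. ennreal (chi_square_density k (x - (0 + x * t))) * ennreal (chi_square_density m (0 + x * t)) \<partial>lborel)"
    using True by (intro nn_integral_real_affine) auto
  also have "(\<integral>\<^sup>+t. ennreal (chi_square_density k (x - (0 + x * t))) * ennreal (chi_square_density m (0 + x * t)) \<partial>lborel)
      = (\<integral>\<^sup>+t. ennreal C * (ennreal (t powr (b - 1) * (1 - t) powr (a - 1)) * indicator {0..1} t) \<partial>lborel)"
  proof (intro nn_integral_cong_AE, use AE_lborel_singleton[of 0] AE_lborel_singleton[of 1] in eventually_elim)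
    fix t :: real assume t: "t \<noteq> 0" "t \<noteq> 1"
    show "ennreal (chi_square_density k (x - (0 + x * t))) * ennreal (chi_square_density m (0 + x * t))
        = ennreal C * (ennreal (t powr (b - 1) * (1 - t) powr (a - 1)) * indicator {0..1} t)"
    proof (cases "0 < t \<and> t < 1")
      case True
      then show ?thesis using pt[of t] C
        by (simp add: ennreal_mult'[symmetric] chi_square_density_nonneg)
    next
      case False
      then have "t < 0 \<or> 1 < t" using t by auto
      then show ?thesis
        using \<open>0 < x\<close> by (auto simp: chi_square_density_def zero_less_mult_iff)
    qed
  qed
  also have "\<dots> = ennreal C * ennreal (Beta b a)"
    using nn_integral_has_integral_lebesgue'[OF _ has_integral_Beta_real[OF ab(2,1)]]
    by (subst nn_integral_cmult) auto
  also have "\<bar>x\<bar> * (ennreal C * ennreal (Beta b a)) = ennreal (x * C * Beta b a)"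
    using True C by (simp add: ennreal_mult' mult.assoc)
  also have "x * C * Beta b a = chi_square_density (k + m) x"
  proof -
    have "x powr (a + b - 1) = x * x powr (a + b - 2)"
      using True powr_mult_base[of x "a + b - 2"] by simp
    moreover have "Gamma a \<noteq> 0" "Gamma b \<noteq> 0"
      using ab Gamma_real_pos by (metis less_irrefl)+
    moreover have "real (k + m) / 2 = a + b" by (simp add: a_def b_def add_divide_distrib)
    then have "chi_square_density (k + m) x
        = x powr (a + b - 1) * exp (- x / 2) / (2 powr (a + b) * Gamma (a + b))"
      using True by (simp only: chi_square_density_def if_True)
    ultimately show ?thesis
      by (simp add: C_def Beta_def add.commute)
  qed
  finally show ?thesis .
qed

lemma (in prob_space) sum_squares_indep_std_normal:
  assumes "finite I" "I \<noteq> {}" "indep_vars (\<lambda>_. borel) X I"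
    and "\<And>i. i \<in> I \<Longrightarrow> distr M borel (X i) = std_normal"
  shows "distributed M lborel (\<lambda>\<omega>. \<Sum>i\<in>I. (X i \<omega>)\<^sup>2) (\<lambda>x. ennreal (chi_square_density (card I) x))"
  using assms
proof (induct I rule: finite_ne_induct)
  have square: "distributed M lborel (\<lambda>\<omega>. (X i \<omega>)\<^sup>2) (\<lambda>x. ennreal (chi_square_density 1 x))"
    if [measurable]: "X i \<in> borel_measurable M" and "distr M borel (X i) = std_normal" for i
  proof -
    have "distr M borel (\<lambda>\<omega>. (X i \<omega>)\<^sup>2) = distr (distr M borel (X i)) borel (\<lambda>z. z\<^sup>2)"
      by (subst distr_distr) (auto simp: comp_def)
    moreover have "distr M lborel (\<lambda>\<omega>. (X i \<omega>)\<^sup>2) = distr M borel (\<lambda>\<omega>. (X i \<omega>)\<^sup>2)"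
      by (rule distr_cong) auto
    ultimately show ?thesis
      using that(2) distr_std_normal_square by (simp add: distributed_def)
  qed
  {
    case (singleton i)
    then show ?case by (auto intro!: square simp: indep_vars_def simp del: One_nat_def simp flip: One_nat_def)
  next
    case (insert i I)
    have [measurable]: "X i \<in> borel_measurable M"
      using insert.prems(1) by (auto simp: indep_vars_def)
    have "indep_vars (\<lambda>_. borel) (\<lambda>i \<omega>. (X i \<omega>)\<^sup>2) (insert i I)"
      by (rule indep_vars_compose2[OF insert.prems(1)]) simp
    then have "indep_var borel (\<lambda>\<omega>. (X i \<omega>)\<^sup>2) borel (\<lambda>\<omega>. \<Sum>i\<in>I. (X i \<omega>)\<^sup>2)"
      using insert by (intro indep_vars_sum) auto
    moreover have "distributed M lborel (\<lambda>\<omega>. \<Sum>i\<in>I. (X i \<omega>)\<^sup>2) (\<lambda>x. ennreal (chi_square_density (card I) x))"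
      using insert by (intro insert(4)) (auto intro: indep_vars_subset)
    ultimately have "distributed M lborel (\<lambda>\<omega>. (X i \<omega>)\<^sup>2 + (\<Sum>i\<in>I. (X i \<omega>)\<^sup>2))
        (\<lambda>x. \<integral>\<^sup>+y. ennreal (chi_square_density 1 (x - y)) * ennreal (chi_square_density (card I) y) \<partial>lborel)"
      using insert.prems by (intro distributed_convolution square) auto
    then show ?case
      using insert by (simp add: chi_square_density_convolution card_gt_0_iff)
  }
qed

subsection \<open>Reflections and orthonormal bases\<close>

lemma reflection_exchanging:
  fixes y z :: "'a::euclidean_space"
  assumes "norm y = norm z"
  obtains T where "orthogonal_transformation T" "T y = z" "\<And>x. x \<bullet> y = 0 \<Longrightarrow> x \<bullet> z = 0 \<Longrightarrow> T x = x"
proof -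
  define a where "a = y - z"
  define T where "T x = x - (2 * (x \<bullet> a) / (a \<bullet> a)) *\<^sub>R a" for x
  have "linear T"
    by (rule linearI) (simp_all add: T_def inner_add_left add_divide_distrib algebra_simps)
  moreover have "T x \<bullet> T w = x \<bullet> w" for x w
    by (cases "a = 0") (simp_all add: T_def inner_diff_left inner_diff_right inner_commute[of a w] field_simps)
  ultimately have "orthogonal_transformation T"
    by (simp add: orthogonal_transformation_def)
  moreover have "T y = z"
  proof (cases "a = 0")
    case False
    have "2 * (y \<bullet> a) = a \<bullet> a"
      using assms by (simp add: a_def inner_diff_left inner_diff_right inner_commute[of z y] norm_eq)
    then have "T y = y - (a \<bullet> a / (a \<bullet> a)) *\<^sub>R a" by (simp only: T_def)
    also have "\<dots> = z" using False by (simp add: a_def)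
    finally show ?thesis .
  qed (simp add: T_def a_def)
  moreover have "T x = x" if "x \<bullet> y = 0" "x \<bullet> z = 0" for x
    using that by (simp add: T_def a_def inner_diff_right)
  ultimately show ?thesis by (rule that)
qed

lemma orthonormal_extension:
  fixes S :: "'a::euclidean_space set"
  assumes "pairwise orthogonal S" "\<forall>x\<in>S. norm x = 1"
  shows "\<exists>C. S \<inter> C = {} \<and> finite (S \<union> C) \<and> card (S \<union> C) = DIM('a) \<and>
    pairwise orthogonal (S \<union> C) \<and> (\<forall>x\<in>S \<union> C. norm x = 1)"
proof -
  have indS: "independent S" using assms by (intro pairwise_orthogonal_independent) (use assms(2) in auto)
  obtain C where C: "C \<subseteq> {y. \<forall>x\<in>span S. orthogonal x y}" "pairwise orthogonal C"
      "\<And>x. x \<in> C \<Longrightarrow> norm x = 1" "independent C" "card C = dim {y. \<forall>x\<in>span S. orthogonal x y}"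
    by (rule orthonormal_basis_subspace[OF subspace_orthogonal_to_vectors[of "span S"]]) (rule that; blast)
  have orth: "orthogonal x y" if "x \<in> S" "y \<in> C" for x y
    using that C(1) by (auto intro: span_base)
  have disj: "S \<inter> C = {}"
  proof (rule ccontr)
    assume "S \<inter> C \<noteq> {}"
    then obtain x where "x \<in> S" "x \<in> C" by blast
    then show False using orth[of x x] C(3)[of x] by (simp add: orthogonal_self)
  qed
  have "dim {y. \<forall>x\<in>span S. orthogonal x y} + dim (span S) = DIM('a)"
    using dim_subspace_orthogonal_to_vectors[of "span S" UNIV] by simp
  then have "card S + card C = DIM('a)"
    using dim_eq_card_independent[OF indS] C(5) by simp
  then have card: "card (S \<union> C) = DIM('a)"
    using disj independent_imp_finite[OF indS] independent_imp_finite[OF C(4)] by (simp add: card_Un_disjoint)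
  have orthogonal: "pairwise orthogonal (S \<union> C)"
    using assms(1) C(2) orth by (auto simp: pairwise_def intro: orth[THEN orthogonal_commute[THEN iffD1]])
  have fin: "finite (S \<union> C)"
    using independent_imp_finite[OF indS] independent_imp_finite[OF C(4)] by simp
  have norm: "norm x = 1" if "x \<in> S \<union> C" for x
    using that C(3) assms(2) by auto
  show ?thesis
    using disj fin card orthogonal norm by (intro exI[of _ C] conjI ballI)
qed

lemma std_gauss_inner:
  fixes e :: "'a::euclidean_space"
  assumes "norm e = 1"
  shows "distr std_gauss borel (\<lambda>x. x \<bullet> e) = std_normal"
proof -
  obtain C where C: "finite ({e} \<union> C)" "card ({e} \<union> C) = DIM('a)"
      "pairwise orthogonal ({e} \<union> C)" "\<forall>b\<in>{e} \<union> C. norm b = 1"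
    using orthonormal_extension[of "{e}"] assms by force
  show ?thesis by (rule std_gauss_coordinate[OF C(1,2) _ C(3)]) (use C(4) in auto)
qed

lemma AE_std_gauss_inner_nonzero:
  fixes e :: "'a::euclidean_space"
  assumes "norm e = 1"
  shows "AE x in std_gauss. x \<bullet> e \<noteq> 0"
proof -
  have "AE z in std_normal. z \<noteq> 0"
    using AE_lborel_singleton[of "0::real"] by (simp add: AE_density) (auto elim: eventually_mono)
  then have "AE z in distr std_gauss borel (\<lambda>x. x \<bullet> e). z \<noteq> 0"
    by (simp only: std_gauss_inner[OF assms])
  then show ?thesis by (subst (asm) AE_distr_iff) auto
qed

subsection \<open>Linear functionals of a rotation invariant law\<close>

definition reject :: "'a::euclidean_space set \<Rightarrow> 'a \<Rightarrow> 'a" where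
  "reject K x = x - (\<Sum>k\<in>K. (x \<bullet> k) *\<^sub>R k)"

lemma reject_measurable [measurable]: "reject K \<in> borel_measurable borel"
  unfolding reject_def[abs_def] by measurable

lemma inner_reject_orthogonal: "(\<And>k. k \<in> K \<Longrightarrow> k \<bullet> y = 0) \<Longrightarrow> reject K x \<bullet> y = x \<bullet> y"
  by (simp add: reject_def inner_diff_left inner_sum_left)

locale orthonormal =
  fixes K :: "'a::euclidean_space set"
  assumes pairwise_orthogonal: "pairwise orthogonal K"
    and norm_eq_one: "k \<in> K \<Longrightarrow> norm k = 1"
begin

lemma finite_K [simp]: "finite K"
  using pairwise_orthogonal by (rule pairwise_orthogonal_imp_finite)

lemma inner_reject_eq_zero:
  assumes "k \<in> K"
  shows "reject K x \<bullet> k = 0" "k \<bullet> reject K x = 0"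
proof -
  have "(\<Sum>j\<in>K. (x \<bullet> j) * (j \<bullet> k)) = (\<Sum>j\<in>K. if j = k then x \<bullet> k else 0)"
    using assms pairwise_orthogonal norm_eq_one[of k]
    by (intro sum.cong) (auto simp: pairwise_def orthogonal_def norm_eq_1)
  then show "reject K x \<bullet> k = 0"
    using assms by (simp add: reject_def inner_diff_left inner_sum_left)
  then show "k \<bullet> reject K x = 0" by (simp add: inner_commute)
qed

lemma norm_reject: "(norm (reject K x))\<^sup>2 = (norm x)\<^sup>2 - (\<Sum>k\<in>K. (x \<bullet> k)\<^sup>2)"
proof -
  have "(norm (reject K x))\<^sup>2 = reject K x \<bullet> x"
    unfolding power2_norm_eq_inner
    by (subst (2) reject_def) (simp add: inner_diff_right inner_sum_right inner_reject_eq_zero)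
  also have "\<dots> = x \<bullet> x - (\<Sum>k\<in>K. (x \<bullet> k) * (k \<bullet> x))"
    by (simp add: reject_def inner_diff_left inner_sum_left)
  finally show ?thesis
    by (simp add: power2_norm_eq_inner[of x] power2_eq_square[of "_ \<bullet> _"] inner_commute)
qed

lemma reject_orthogonal_transformation:
  assumes T: "orthogonal_transformation T" and "\<And>k. k \<in> K \<Longrightarrow> T k = k"
  shows "reject K (T x) = T (reject K x)"
proof -
  have lin: "linear T" using T by (rule orthogonal_transformation_linear)
  have "T x \<bullet> k = x \<bullet> k" if "k \<in> K" for k
    using T assms(2)[OF that] by (metis orthogonal_transformation_def)
  then show ?thesis
    by (simp add: reject_def linear_diff[OF lin] linear_sum[OF lin] linear_scale[OF lin] assms(2))
qed

end

locale rotation_invariant = orthonormal K + M: prob_space M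
  for K :: "'a::euclidean_space set" and M :: "'a measure" +
  fixes s :: real
  assumes sets_M [measurable_cong, simp]: "sets M = sets borel"
    and radius: "AE x in M. norm (reject K x) = s"
    and invariant: "orthogonal_transformation T \<Longrightarrow> (\<And>k. k \<in> K \<Longrightarrow> T k = k) \<Longrightarrow> distr M borel T = M"
begin

lemma space_M [simp]: "space M = UNIV"
  using sets_eq_imp_space_eq[OF sets_M] by simp

lemma radius_nonneg: "0 \<le> s"
proof -
  have "AE x in M. 0 \<le> s" using radius by eventually_elim auto
  then show ?thesis by simp
qed

text \<open>Averaging \<open>x \<bullet> w\<close> over the Gaussian direction \<open>w = reject K g\<close> and exchanging the integrals
  determines the law of a linear functional under any measure with the required symmetries, so
  no construction or uniqueness theorem for the surface measure is needed.\<close>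

lemma distr_inner:
  assumes e: "norm e = 1" "\<And>k. k \<in> K \<Longrightarrow> k \<bullet> e = 0"
  shows "distr M borel (\<lambda>x. x \<bullet> e) = distr std_gauss borel (\<lambda>g. s * (g \<bullet> e) / norm (reject K g))"
proof (rule measure_eqI)
  interpret G: prob_space "std_gauss :: 'a measure" by (rule prob_space_std_gauss)
  interpret GM: pair_sigma_finite "std_gauss :: 'a measure" M ..
  fix S assume "S \<in> sets (distr M borel (\<lambda>x. x \<bullet> e))"
  then have [measurable]: "S \<in> sets borel" by simp
  define E where "E = {p. (reject K (fst p) \<bullet> snd p) / norm (reject K (fst p)) \<in> S}"
  have "(\<lambda>p. (reject K (fst p) \<bullet> snd p) / norm (reject K (fst p))) \<in> borel_measurable (std_gauss \<Otimes>\<^sub>M M)"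
    by measurable
  from measurable_sets[OF this, of S] have [measurable]: "E \<in> sets (std_gauss \<Otimes>\<^sub>M M)"
    by (simp add: E_def vimage_def space_pair_measure)
  have inner: "emeasure M (Pair g -` E) = emeasure (distr M borel (\<lambda>x. x \<bullet> e)) S"
    if "reject K g \<noteq> 0" for g
  proof -
    let ?w = "reject K g /\<^sub>R norm (reject K g)"
    have "norm e = norm ?w" using that e by simp
    then obtain T where T: "orthogonal_transformation T" "T e = ?w"
        "\<And>x. x \<bullet> e = 0 \<Longrightarrow> x \<bullet> ?w = 0 \<Longrightarrow> T x = x"
      using reflection_exchanging by blast
    have fixK: "T k = k" if "k \<in> K" for k
      using that e(2) by (intro T(3)) (auto simp: inner_reject_eq_zero)
    have [measurable]: "T \<in> borel_measurable borel" by (rule orthogonal_transformation_measurable[OF T(1)])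
    have "emeasure M (Pair g -` E) = emeasure M {x. x \<bullet> ?w \<in> S}"
      by (auto simp: E_def inner_commute divide_inverse mult.commute intro!: arg_cong[where f = "emeasure M"])
    also have "\<dots> = emeasure (distr M borel T) {x. x \<bullet> ?w \<in> S}"
      using invariant[OF T(1) fixK] by simp
    also have "\<dots> = emeasure M {x. T x \<bullet> T e \<in> S}"
      unfolding T(2) by (subst emeasure_distr) (auto simp: vimage_def)
    also have "\<dots> = emeasure (distr M borel (\<lambda>x. x \<bullet> e)) S"
      using T(1) by (subst emeasure_distr) (auto simp: vimage_def orthogonal_transformation_def)
    finally show ?thesis .
  qed
  have nz: "AE g in std_gauss. reject K g \<noteq> 0"
    using AE_std_gauss_inner_nonzero[OF e(1)]
  proof eventually_elim
    case (elim g)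
    then show ?case using inner_reject_orthogonal[of K e g] e(2) by auto
  qed
  have outer: "emeasure std_gauss ((\<lambda>g. (g, x)) -` E)
      = emeasure (distr std_gauss borel (\<lambda>g. s * (g \<bullet> e) / norm (reject K g))) S"
    if x: "norm (reject K x) = s" for x
  proof -
    let ?y = "reject K x"
    have "norm (s *\<^sub>R e) = norm ?y" using e x radius_nonneg by simp
    then obtain T where T: "orthogonal_transformation T" "T (s *\<^sub>R e) = ?y"
        "\<And>x. x \<bullet> (s *\<^sub>R e) = 0 \<Longrightarrow> x \<bullet> ?y = 0 \<Longrightarrow> T x = x"
      using reflection_exchanging by blast
    have fixK: "T k = k" if "k \<in> K" for k
      using that e(2) by (intro T(3)) (auto simp: inner_reject_eq_zero)
    have [measurable]: "T \<in> borel_measurable borel" by (rule orthogonal_transformation_measurable[OF T(1)])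
    have eq: "reject K g \<bullet> x = g \<bullet> ?y" for g
      by (simp add: reject_def inner_diff_left inner_diff_right inner_sum_left inner_sum_right inner_commute mult.commute)
    have "emeasure std_gauss ((\<lambda>g. (g, x)) -` E) = emeasure (distr std_gauss borel T) {g. (g \<bullet> ?y) / norm (reject K g) \<in> S}"
      by (simp add: E_def vimage_def eq distr_std_gauss_orthogonal[OF T(1)])
    also have "\<dots> = emeasure std_gauss {g. (T g \<bullet> T (s *\<^sub>R e)) / norm (reject K (T g)) \<in> S}"
      unfolding T(2) by (subst emeasure_distr) (auto simp: vimage_def)
    also have "\<dots> = emeasure std_gauss {g. s * (g \<bullet> e) / norm (reject K g) \<in> S}"
    proof -
      have "T g \<bullet> T (s *\<^sub>R e) = s * (g \<bullet> e)" for g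
        using T(1) by (simp add: orthogonal_transformation_def)
      moreover have "norm (reject K (T g)) = norm (reject K g)" for g
        using T(1) fixK by (simp add: reject_orthogonal_transformation orthogonal_transformation_norm)
      ultimately show ?thesis by (simp only:)
    qed
    also have "\<dots> = emeasure (distr std_gauss borel (\<lambda>g. s * (g \<bullet> e) / norm (reject K g))) S"
      by (subst emeasure_distr) (auto simp: vimage_def)
    finally show ?thesis .
  qed
  have "emeasure (distr M borel (\<lambda>x. x \<bullet> e)) S
      = (\<integral>\<^sup>+g. emeasure (distr M borel (\<lambda>x. x \<bullet> e)) S \<partial>(std_gauss :: 'a measure))"
    using G.emeasure_space_1 by simp
  also have "\<dots> = (\<integral>\<^sup>+g. emeasure M (Pair g -` E) \<partial>std_gauss)"
    by (intro nn_integral_cong_AE) (use nz in eventually_elim, simp add: inner)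
  also have "\<dots> = emeasure (std_gauss \<Otimes>\<^sub>M M) E"
    by (rule M.emeasure_pair_measure_alt[symmetric]) measurable
  also have "\<dots> = (\<integral>\<^sup>+x. emeasure std_gauss ((\<lambda>g. (g, x)) -` E) \<partial>M)"
    by (rule GM.emeasure_pair_measure_alt2) measurable
  also have "\<dots> = (\<integral>\<^sup>+x. emeasure (distr std_gauss borel (\<lambda>g. s * (g \<bullet> e) / norm (reject K g))) S \<partial>M)"
    by (intro nn_integral_cong_AE) (use radius in eventually_elim, simp add: outer)
  also have "\<dots> = emeasure (distr std_gauss borel (\<lambda>g. s * (g \<bullet> e) / norm (reject K g))) S"
    using M.emeasure_space_1 by simp
  finally show "emeasure (distr M borel (\<lambda>x. x \<bullet> e)) S
      = emeasure (distr std_gauss borel (\<lambda>g. s * (g \<bullet> e) / norm (reject K g))) S" .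
qed simp

end

subsection \<open>The Gaussian ratio\<close>

lemma (in prob_space) prob_le_ratio_chi_square:
  assumes indep: "indep_var borel X borel Y"
    and X: "distributed M lborel X (\<lambda>x. ennreal (chi_square_density 1 x))"
    and Y: "distributed M lborel Y (\<lambda>x. ennreal (chi_square_density m x))"
  shows "\<P>(\<omega> in M. Y \<omega> \<le> \<kappa> * X \<omega>) = (LINT t:{0..}|lborel. chi_square_density 1 t * chi_square_cdf m (\<kappa> * t))"
    and "\<P>(\<omega> in M. Y \<omega> < \<kappa> * X \<omega>) = (LINT t:{0..}|lborel. chi_square_density 1 t * chi_square_cdf m (\<kappa> * t))"
proof -
  let ?D = "\<lambda>k. density lborel (\<lambda>x. ennreal (chi_square_density k x))"
  have [measurable]: "X \<in> borel_measurable M" "Y \<in> borel_measurable M"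
    using X Y by (auto simp: distributed_def)
  have distr: "distr M borel X = ?D 1" "distr M borel Y = ?D m"
    using X Y by (auto simp: distributed_def cong: distr_cong)
  interpret D: prob_space "?D m"
    unfolding distr(2)[symmetric] by (rule prob_space_distr) simp
  have joint: "distr M (borel \<Otimes>\<^sub>M borel) (\<lambda>\<omega>. (X \<omega>, Y \<omega>)) = ?D 1 \<Otimes>\<^sub>M ?D m"
    using indep by (simp add: indep_var_distribution_eq distr)
  have cdf: "emeasure (?D m) {..x} = ennreal (chi_square_cdf m x)" for x
    by (simp add: chi_square_cdf_def cdf_def D.emeasure_eq_measure)
  have "emeasure (?D m) {..<x} = emeasure (?D m) {..x}" for x
    by (simp add: emeasure_density)
      (rule nn_integral_cong_AE, use AE_lborel_singleton[of x] in eventually_elim, auto split: split_indicator)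
  then have cdf': "emeasure (?D m) {..<x} = ennreal (chi_square_cdf m x)" for x
    by (simp add: cdf)
  have "mono (chi_square_cdf m)"
    unfolding chi_square_cdf_def cdf_def by (auto intro!: monoI D.finite_measure_mono)
  then have [measurable]: "chi_square_cdf m \<in> borel_measurable borel"
    by (rule borel_measurable_mono)
  have zero: "chi_square_density k x = 0" if "\<not> 0 \<le> x" for k x
    using that by (simp add: chi_square_density_def)
  have cdf_nonneg: "0 \<le> chi_square_cdf m x" for x
    by (simp add: chi_square_cdf_def cdf_def)
  have main: "measure M {\<omega> \<in> space M. R (X \<omega>) (Y \<omega>)}
      = (LINT t:{0..}|lborel. chi_square_density 1 t * chi_square_cdf m (\<kappa> * t))"
    if pred: "Measurable.pred (borel \<Otimes>\<^sub>M borel) (\<lambda>p. R (fst p) (snd p))"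
      and slice: "\<And>x. emeasure (?D m) {y. R x y} = ennreal (chi_square_cdf m (\<kappa> * x))" for R
  proof -
    have R: "{p. R (fst p) (snd p)} \<in> sets (borel \<Otimes>\<^sub>M borel)"
      using pred by (simp add: pred_def space_pair_measure)
    have "emeasure M {\<omega> \<in> space M. R (X \<omega>) (Y \<omega>)}
        = emeasure (distr M (borel \<Otimes>\<^sub>M borel) (\<lambda>\<omega>. (X \<omega>, Y \<omega>))) {p. R (fst p) (snd p)}"
      using R by (subst emeasure_distr) (auto intro!: arg_cong[where f = "emeasure M"])
    also have "\<dots> = (\<integral>\<^sup>+x. emeasure (?D m) (Pair x -` {p. R (fst p) (snd p)}) \<partial>?D 1)"
      unfolding joint using R by (intro D.emeasure_pair_measure_alt) (simp cong: sets_pair_measure_cong)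
    also have "\<dots> = (\<integral>\<^sup>+x. ennreal (chi_square_cdf m (\<kappa> * x)) \<partial>?D 1)"
      by (simp add: vimage_def slice)
    also have "\<dots> = (\<integral>\<^sup>+x. ennreal (chi_square_density 1 x) * ennreal (chi_square_cdf m (\<kappa> * x)) \<partial>lborel)"
      by (subst nn_integral_density) auto
    also have "\<dots> = (\<integral>\<^sup>+x. ennreal (indicator {0..} x *\<^sub>R (chi_square_density 1 x * chi_square_cdf m (\<kappa> * x))) \<partial>lborel)"
      by (intro nn_integral_cong)
        (auto simp: ennreal_mult chi_square_density_nonneg cdf_nonneg zero split: split_indicator)
    finally show ?thesis
      unfolding set_lebesgue_integral_def measure_def
      by (subst integral_eq_nn_integral) (auto intro!: mult_nonneg_nonneg chi_square_density_nonneg cdf_nonneg)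
  qed
  show "\<P>(\<omega> in M. Y \<omega> \<le> \<kappa> * X \<omega>) = (LINT t:{0..}|lborel. chi_square_density 1 t * chi_square_cdf m (\<kappa> * t))"
    by (rule main, measurable) (simp add: cdf[unfolded atMost_def])
  show "\<P>(\<omega> in M. Y \<omega> < \<kappa> * X \<omega>) = (LINT t:{0..}|lborel. chi_square_density 1 t * chi_square_cdf m (\<kappa> * t))"
    by (rule main, measurable) (simp add: cdf'[unfolded lessThan_def])
qed

lemma abs_ratio_iff:
  fixes a b c s :: real
  assumes "0 < c" "0 \<le> s" "a \<noteq> 0" "0 \<le> b" "0 \<le> d" "d\<^sup>2 = a\<^sup>2 + b"
  shows "c \<le> \<bar>s * a / d\<bar> \<longleftrightarrow> b \<le> (s\<^sup>2 - c\<^sup>2) / c\<^sup>2 * a\<^sup>2"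
    and "c < \<bar>s * a / d\<bar> \<longleftrightarrow> b < (s\<^sup>2 - c\<^sup>2) / c\<^sup>2 * a\<^sup>2"
proof -
  have "0 < d\<^sup>2" using assms by (simp add: add_pos_nonneg)
  then have d: "0 < d" using assms(5) by (cases "d = 0") auto
  have abs: "\<bar>s * a / d\<bar> = s * \<bar>a\<bar> / d" using assms d by (simp add: abs_mult)
  have cd: "(c * d)\<^sup>2 = c\<^sup>2 * (a\<^sup>2 + b)" "(s * \<bar>a\<bar>)\<^sup>2 = s\<^sup>2 * a\<^sup>2"
    using assms(6) by (auto simp: power_mult_distrib)
  have nonneg: "0 \<le> c * d" "0 \<le> s * \<bar>a\<bar>" using assms d by auto
  have "c \<le> \<bar>s * a / d\<bar> \<longleftrightarrow> c * d \<le> s * \<bar>a\<bar>"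
    unfolding abs using d by (simp add: field_simps)
  also have "\<dots> \<longleftrightarrow> (c * d)\<^sup>2 \<le> (s * \<bar>a\<bar>)\<^sup>2"
    using nonneg by (simp add: power_mono_iff)
  also have "\<dots> \<longleftrightarrow> b \<le> (s\<^sup>2 - c\<^sup>2) / c\<^sup>2 * a\<^sup>2"
    unfolding cd using assms(1) by (simp add: field_simps)
  finally show "c \<le> \<bar>s * a / d\<bar> \<longleftrightarrow> b \<le> (s\<^sup>2 - c\<^sup>2) / c\<^sup>2 * a\<^sup>2" .
  have "c < \<bar>s * a / d\<bar> \<longleftrightarrow> c * d < s * \<bar>a\<bar>"
    unfolding abs using d by (simp add: field_simps)
  also have "\<dots> \<longleftrightarrow> (c * d)\<^sup>2 < (s * \<bar>a\<bar>)\<^sup>2"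
    using nonneg power_mono_iff[of "s * \<bar>a\<bar>" "c * d" 2] by (simp add: linorder_not_le[symmetric])
  also have "\<dots> \<longleftrightarrow> b < (s\<^sup>2 - c\<^sup>2) / c\<^sup>2 * a\<^sup>2"
    unfolding cd using assms(1) by (simp add: field_simps)
  finally show "c < \<bar>s * a / d\<bar> \<longleftrightarrow> b < (s\<^sup>2 - c\<^sup>2) / c\<^sup>2 * a\<^sup>2" .
qed

context orthonormal
begin

lemma prob_std_gauss_ratio:
  fixes e :: 'a and c s :: real
  assumes e: "norm e = 1" "\<And>k. k \<in> K \<Longrightarrow> k \<bullet> e = 0"
    and dim: "DIM('a) = card K + 1 + m" "0 < m"
    and cs: "0 < c" "0 \<le> s"
  defines "I \<equiv> (LINT t:{0..}|lborel. chi_square_density 1 t * chi_square_cdf m ((s\<^sup>2 - c\<^sup>2) / c\<^sup>2 * t))"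
  shows "measure std_gauss {g. c \<le> \<bar>s * (g \<bullet> e) / norm (reject K g)\<bar>} = I"
    and "measure std_gauss {g. c < \<bar>s * (g \<bullet> e) / norm (reject K g)\<bar>} = I"
proof -
  interpret prob_space "std_gauss :: 'a measure" by (rule prob_space_std_gauss)
  have "e \<notin> K" using e(1) e(2)[of e] by (auto simp: norm_eq_1)
  have orth: "pairwise orthogonal (insert e K)"
    using pairwise_orthogonal e(2) by (auto simp: pairwise_insert orthogonal_def inner_commute)
  have norm: "\<forall>x\<in>insert e K. norm x = 1" using e(1) norm_eq_one by auto
  obtain C where C: "insert e K \<inter> C = {}" "finite (insert e K \<union> C)" "card (insert e K \<union> C) = DIM('a)"
    "pairwise orthogonal (insert e K \<union> C)" and normB: "\<forall>x\<in>insert e K \<union> C. norm x = 1"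
    using orthonormal_extension[OF orth norm] by (elim exE conjE)
  note C = C normB[rule_format]
  let ?B = "insert e K \<union> C"
  have fin: "finite C" using C(2) by simp
  have "card ?B = card K + 1 + card C"
    using C(1) fin \<open>e \<notin> K\<close> by (subst card_Un_disjoint) auto
  then have cardC: "card C = m" using C(3) dim by simp
  note indep = indep_vars_std_gauss[OF C(2,3,5,4)]
  define X where "X g = (g \<bullet> e)\<^sup>2" for g :: 'a
  define Y where "Y g = (\<Sum>b\<in>C. (g \<bullet> b)\<^sup>2)" for g :: 'a
  have normr: "(norm (reject K g))\<^sup>2 = (g \<bullet> e)\<^sup>2 + Y g" for g
  proof -
    have "(norm g)\<^sup>2 = (\<Sum>b\<in>?B. (g \<bullet> b)\<^sup>2)"
      by (rule sum_inner_orthonormal_basis[OF C(2,3,5,4), symmetric])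
    also have "\<dots> = (\<Sum>b\<in>insert e K. (g \<bullet> b)\<^sup>2) + Y g"
      unfolding Y_def using C(1) fin by (intro sum.union_disjoint) auto
    also have "(\<Sum>b\<in>insert e K. (g \<bullet> b)\<^sup>2) = (g \<bullet> e)\<^sup>2 + (\<Sum>b\<in>K. (g \<bullet> b)\<^sup>2)"
      using \<open>e \<notin> K\<close> by simp
    finally show ?thesis by (simp add: norm_reject)
  qed
  have normal: "distr std_gauss borel (\<lambda>g. g \<bullet> b) = std_normal" if "b \<in> ?B" for b
    using that by (intro std_gauss_inner C(5))
  have "distributed std_gauss lborel (\<lambda>g. \<Sum>b\<in>{e}. (g \<bullet> b)\<^sup>2) (\<lambda>x. ennreal (chi_square_density (card {e}) x))"
    using normal by (intro sum_squares_indep_std_normal indep_vars_subset[OF indep]) auto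
  then have X: "distributed std_gauss lborel X (\<lambda>x. ennreal (chi_square_density 1 x))"
    by (simp add: X_def[abs_def])
  have "C \<noteq> {}" using cardC dim by auto
  then have Y: "distributed std_gauss lborel Y (\<lambda>x. ennreal (chi_square_density m x))"
    unfolding Y_def[abs_def] cardC[symmetric]
    using normal fin by (intro sum_squares_indep_std_normal indep_vars_subset[OF indep]) auto
  have "indep_vars (\<lambda>_. borel) (\<lambda>b g. g \<bullet> b) (insert e C)"
    by (rule indep_vars_subset[OF indep]) auto
  then have "indep_vars (\<lambda>_. borel) (\<lambda>b g. (g \<bullet> b)\<^sup>2) (insert e C)"
    by (rule indep_vars_compose2) simp
  then have "indep_var borel X borel Y"
    unfolding X_def[abs_def] Y_def[abs_def] using C(1) fin by (intro indep_vars_sum) auto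
  note P = prob_le_ratio_chi_square[OF this X Y, of "(s\<^sup>2 - c\<^sup>2) / c\<^sup>2", folded I_def]
  have [measurable]: "X \<in> borel_measurable borel" "Y \<in> borel_measurable borel"
    unfolding X_def[abs_def] Y_def[abs_def] by measurable
  have Ynn: "0 \<le> Y g" for g by (simp add: Y_def sum_nonneg)
  have "AE g in std_gauss. c \<le> \<bar>s * (g \<bullet> e) / norm (reject K g)\<bar> \<longleftrightarrow> Y g \<le> (s\<^sup>2 - c\<^sup>2) / c\<^sup>2 * X g"
    using AE_std_gauss_inner_nonzero[OF e(1)]
    by eventually_elim (unfold X_def, intro abs_ratio_iff cs Ynn normr norm_ge_zero)
  then have "measure std_gauss {g. c \<le> \<bar>s * (g \<bullet> e) / norm (reject K g)\<bar>}
      = measure std_gauss {g. Y g \<le> (s\<^sup>2 - c\<^sup>2) / c\<^sup>2 * X g}"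
    by (intro finite_measure_eq_AE) (auto elim: eventually_mono)
  with P(1) show "measure std_gauss {g. c \<le> \<bar>s * (g \<bullet> e) / norm (reject K g)\<bar>} = I" by simp
  have "AE g in std_gauss. c < \<bar>s * (g \<bullet> e) / norm (reject K g)\<bar> \<longleftrightarrow> Y g < (s\<^sup>2 - c\<^sup>2) / c\<^sup>2 * X g"
    using AE_std_gauss_inner_nonzero[OF e(1)]
    by eventually_elim (unfold X_def, intro abs_ratio_iff cs Ynn normr norm_ge_zero)
  then have "measure std_gauss {g. c < \<bar>s * (g \<bullet> e) / norm (reject K g)\<bar>}
      = measure std_gauss {g. Y g < (s\<^sup>2 - c\<^sup>2) / c\<^sup>2 * X g}"
    by (intro finite_measure_eq_AE) (auto elim: eventually_mono)
  with P(2) show "measure std_gauss {g. c < \<bar>s * (g \<bullet> e) / norm (reject K g)\<bar>} = I" by simp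
qed

end

context rotation_invariant
begin

lemma distr_inner_symmetric:
  assumes e: "norm e = 1" "\<And>k. k \<in> K \<Longrightarrow> k \<bullet> e = 0"
  shows "distr M borel (\<lambda>x. - (x \<bullet> e)) = distr M borel (\<lambda>x. x \<bullet> e)"
proof -
  have "norm (- e) = norm e" by simp
  then obtain T where T: "orthogonal_transformation T" "T (- e) = e"
      "\<And>x. x \<bullet> (- e) = 0 \<Longrightarrow> x \<bullet> e = 0 \<Longrightarrow> T x = x"
    using reflection_exchanging by blast
  have [measurable]: "T \<in> borel_measurable borel" by (rule orthogonal_transformation_measurable[OF T(1)])
  have "T x \<bullet> e = - (x \<bullet> e)" for x
    using T(1) T(2) by (metis inner_minus_right orthogonal_transformation_def)
  then have "distr M borel (\<lambda>x. - (x \<bullet> e)) = distr (distr M borel T) borel (\<lambda>x. x \<bullet> e)"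
    by (subst distr_distr) (auto simp: comp_def)
  also have "distr M borel T = M"
    using e(2) by (intro invariant T) auto
  finally show ?thesis .
qed

lemma prob_inner_tail:
  assumes e: "norm e = 1" "\<And>k. k \<in> K \<Longrightarrow> k \<bullet> e = 0" and "0 < c"
  shows "measure M {x. c \<le> x \<bullet> e} = 1 / 2 * measure M {x. c \<le> \<bar>x \<bullet> e\<bar>}"
    and "measure M {x. x \<bullet> e < - c} = 1 / 2 * measure M {x. c < \<bar>x \<bullet> e\<bar>}"
proof -
  have flip: "measure M {x. x \<bullet> e \<in> S} = measure M {x. - (x \<bullet> e) \<in> S}" if [measurable]: "S \<in> sets borel" for S
  proof -
    have "measure M {x. x \<bullet> e \<in> S} = measure (distr M borel (\<lambda>x. x \<bullet> e)) S"
      by (subst measure_distr) (auto simp: vimage_def)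
    also have "\<dots> = measure (distr M borel (\<lambda>x. - (x \<bullet> e))) S"
      by (simp add: distr_inner_symmetric[OF e])
    also have "\<dots> = measure M {x. - (x \<bullet> e) \<in> S}"
      by (subst measure_distr) (auto simp: vimage_def)
    finally show ?thesis .
  qed
  have "measure M {x. c \<le> \<bar>x \<bullet> e\<bar>} = measure M ({x. c \<le> x \<bullet> e} \<union> {x. c \<le> - (x \<bullet> e)})"
    by (rule arg_cong[where f = "measure M"]) auto
  also have "\<dots> = measure M {x. c \<le> x \<bullet> e} + measure M {x. c \<le> - (x \<bullet> e)}"
    using \<open>0 < c\<close> by (intro M.finite_measure_Union) auto
  finally show "measure M {x. c \<le> x \<bullet> e} = 1 / 2 * measure M {x. c \<le> \<bar>x \<bullet> e\<bar>}"
    using flip[of "{c..}"] by simp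
  have "measure M {x. c < \<bar>x \<bullet> e\<bar>} = measure M ({x. c < x \<bullet> e} \<union> {x. x \<bullet> e < - c})"
    by (rule arg_cong[where f = "measure M"]) auto
  also have "\<dots> = measure M {x. c < x \<bullet> e} + measure M {x. x \<bullet> e < - c}"
    using \<open>0 < c\<close> by (intro M.finite_measure_Union) auto
  finally show "measure M {x. x \<bullet> e < - c} = 1 / 2 * measure M {x. c < \<bar>x \<bullet> e\<bar>}"
    using flip[of "{c<..}"] by (simp add: less_minus_iff)
qed

lemma prob_abs_inner:
  assumes e: "norm e = 1" "\<And>k. k \<in> K \<Longrightarrow> k \<bullet> e = 0" and "DIM('a) = card K + 1 + m" "0 < m" and "0 < c"
  defines "I \<equiv> (LINT t:{0..}|lborel. chi_square_density 1 t * chi_square_cdf m ((s\<^sup>2 - c\<^sup>2) / c\<^sup>2 * t))"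
  shows "measure M {x. c \<le> \<bar>x \<bullet> e\<bar>} = I" and "measure M {x. c < \<bar>x \<bullet> e\<bar>} = I"
proof -
  have law: "measure M {x. x \<bullet> e \<in> S} = measure std_gauss {g. s * (g \<bullet> e) / norm (reject K g) \<in> S}"
    if [measurable]: "S \<in> sets borel" for S
  proof -
    have "measure M {x. x \<bullet> e \<in> S} = measure (distr M borel (\<lambda>x. x \<bullet> e)) S"
      by (subst measure_distr) (auto simp: vimage_def)
    also have "\<dots> = measure (distr std_gauss borel (\<lambda>g. s * (g \<bullet> e) / norm (reject K g))) S"
      by (simp only: distr_inner[OF e])
    also have "\<dots> = measure std_gauss {g. s * (g \<bullet> e) / norm (reject K g) \<in> S}"
      by (subst measure_distr) (auto simp: vimage_def)
    finally show ?thesis .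
  qed
  have [measurable]: "{t::real. c \<le> \<bar>t\<bar>} \<in> sets borel" "{t::real. c < \<bar>t\<bar>} \<in> sets borel"
    by measurable
  show "measure M {x. c \<le> \<bar>x \<bullet> e\<bar>} = I" "measure M {x. c < \<bar>x \<bullet> e\<bar>} = I"
    using law[of "{t. c \<le> \<bar>t\<bar>}"] law[of "{t. c < \<bar>t\<bar>}"]
      prob_std_gauss_ratio[OF e assms(3-5) radius_nonneg] by (simp_all add: I_def)
qed

lemma AE_abs_inner_eq_radius:
  assumes e: "norm e = 1" "\<And>k. k \<in> K \<Longrightarrow> k \<bullet> e = 0" and dim: "DIM('a) = card K + 1"
  shows "AE x in M. \<bar>x \<bullet> e\<bar> = s"
  using radius
proof eventually_elim
  case (elim x)
  have "e \<notin> K" using e(1) e(2)[of e] by (auto simp: norm_eq_1)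
  have "pairwise orthogonal (insert e K)"
    using pairwise_orthogonal e(2) by (auto simp: pairwise_insert orthogonal_def inner_commute)
  then have "(\<Sum>k\<in>insert e K. (x \<bullet> k)\<^sup>2) = (norm x)\<^sup>2"
    using \<open>e \<notin> K\<close> e(1) norm_eq_one dim by (intro sum_inner_orthonormal_basis) auto
  then have "(norm (reject K x))\<^sup>2 = (x \<bullet> e)\<^sup>2"
    using \<open>e \<notin> K\<close> by (simp add: norm_reject)
  then have "\<bar>x \<bullet> e\<bar> = norm (reject K x)"
    using power2_eq_imp_eq[of "\<bar>x \<bullet> e\<bar>" "norm (reject K x)"] by simp
  then show ?case using elim by simp
qed

end

subsection \<open>False correlations\<close>

lemma mean_vec_zero_mean: "zero_mean x \<Longrightarrow> mean_vec x = 0"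
  by (simp add: zero_mean_def mean_vec_def vec_eq_iff)

lemma pearson_unit:
  "zero_mean x \<Longrightarrow> zero_mean y \<Longrightarrow> norm x = 1 \<Longrightarrow> norm y = 1 \<Longrightarrow> pearson x y = x \<bullet> y"
  by (simp add: pearson_def mean_vec_zero_mean)

lemma pearson_measurable [measurable]: "(\<lambda>x. pearson x y) \<in> borel_measurable borel"
proof -
  have [measurable]: "(mean_vec :: real ^ 'n \<Rightarrow> real ^ 'n) \<in> borel_measurable borel"
    unfolding mean_vec_def[abs_def]
    by (intro borel_measurable_continuous_onI continuous_on_vec_lambda continuous_intros) auto
  show ?thesis unfolding pearson_def[abs_def] by measurable
qed

theorem proposition2:
  fixes u v :: "real ^ 'n" and q r :: real
    and P :: "'w measure" and U :: "'w \<Rightarrow> real ^ 'n"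
  assumes "CARD('n) \<ge> 3"
    and "0 < q" and "q \<le> 1"
    and "zero_mean u" and "norm u = 1"
    and "zero_mean v" and "norm v = 1"
    and "r = pearson u v" and "0 < \<bar>r\<bar>" and "\<bar>r\<bar> < 1"
    and "prob_space P" and "U \<in> borel_measurable P"
    and "uniform_on_sphere (corr_sphere u q) (corr_affine u q) (q *\<^sub>R u) (distr P borel U)"
  shows "(r < 0 \<longrightarrow> \<P>(\<omega> in P. pearson (U \<omega>) v \<ge> 0) = h CARD('n) q r)
       \<and> (r > 0 \<and> \<not> (CARD('n) = 3 \<and> (corr_ratio q r)\<^sup>2 = 1 - q\<^sup>2)
            \<longrightarrow> \<P>(\<omega> in P. pearson (U \<omega>) v < 0) = h CARD('n) q r)"
proof -
  define M where "M = distr P borel U"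
  define o1 :: "real ^ 'n" where "o1 = (\<chi> i. 1 / sqrt (real CARD('n)))"
  define K where "K = {u, o1}"
  define s where "s = sqrt (1 - q\<^sup>2)"
  define c where "c = corr_ratio q r"
  define e where "e = (v - r *\<^sub>R u) /\<^sub>R sqrt (1 - r\<^sup>2)"
  note [measurable] = assms(12)
  have zero_mean_iff: "zero_mean x \<longleftrightarrow> x \<bullet> o1 = 0" for x :: "real ^ 'n"
    by (simp add: zero_mean_def o1_def inner_vec_def sum_divide_distrib[symmetric])
  have o1: "norm o1 = 1"
    by (simp add: o1_def norm_eq_1 inner_vec_def)
  have uo: "u \<bullet> o1 = 0" "v \<bullet> o1 = 0" using assms zero_mean_iff by auto
  have uv: "u \<bullet> v = r" using assms pearson_unit by metis
  have r2: "0 < 1 - r\<^sup>2" using assms(10) by (simp add: abs_square_less_1)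
  have q2: "0 \<le> 1 - q\<^sup>2" using assms(2,3) by (simp add: abs_square_le_1)
  have "norm (v - r *\<^sub>R u) = sqrt (1 - r\<^sup>2)"
    using assms(5,7) uv
    by (simp add: norm_eq_sqrt_inner inner_diff_left inner_diff_right inner_commute[of v u] power2_eq_square norm_eq_1)
  then have e: "norm e = 1" using r2 by (simp add: e_def)
  have eK: "k \<bullet> e = 0" if "k \<in> K" for k
    using that uo uv assms(5)
    by (auto simp: K_def e_def inner_diff_right inner_commute[of o1] norm_eq_1)
  have v: "v = r *\<^sub>R u + sqrt (1 - r\<^sup>2) *\<^sub>R e" using r2 by (simp add: e_def)
  have "u \<noteq> o1" using uo o1 by (auto simp: norm_eq_1)
  then have cardK: "card K = 2" by (simp add: K_def)
  have c: "0 < c" using assms(2,9) r2 by (simp add: c_def corr_ratio_def)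
  have unif: "prob_space M" "emeasure M (corr_sphere u q) = 1"
    "\<And>g. orthogonal_transformation g \<Longrightarrow> (\<lambda>x. q *\<^sub>R u + g (x - q *\<^sub>R u)) ` corr_affine u q = corr_affine u q
        \<Longrightarrow> distr M borel (\<lambda>x. q *\<^sub>R u + g (x - q *\<^sub>R u)) = M"
    using assms(13) by (auto simp: uniform_on_sphere_def M_def)
  have sphere: "zero_mean x" "norm x = 1" "x \<bullet> u = q" if "x \<in> corr_sphere u q" for x
    using that pearson_unit[of u x] assms(4,5) by (auto simp: corr_sphere_def inner_commute)
  have affine: "x \<in> corr_affine u q \<longleftrightarrow> x \<bullet> o1 = 0 \<and> x \<bullet> u = q" for x
    by (simp add: corr_affine_def zero_mean_iff inner_commute)
  interpret M: prob_space M by fact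
  interpret orthonormal K
    using o1 assms(5) uo by unfold_locales (auto simp: K_def pairwise_insert orthogonal_def inner_commute)
  have AE_sphere: "AE x in M. x \<in> corr_sphere u q"
  proof -
    have "corr_sphere u q \<in> sets M" using unif(2) emeasure_notin_sets by fastforce
    then show ?thesis using unif(2) by (simp add: M.AE_in_set_eq_1 measure_def)
  qed
  interpret rotation_invariant K M s
  proof
    show "sets M = sets borel" by (simp add: M_def)
    show "AE x in M. norm (reject K x) = s"
      using AE_sphere
    proof eventually_elim
      case (elim x)
      have "(norm (reject K x))\<^sup>2 = 1 - q\<^sup>2"
        unfolding norm_reject using sphere[OF elim] \<open>u \<noteq> o1\<close> by (simp add: K_def zero_mean_iff)
      then show ?case unfolding s_def by (metis norm_ge_zero real_sqrt_unique)
    qed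
    fix T :: "real ^ 'n \<Rightarrow> real ^ 'n"
    assume T: "orthogonal_transformation T" "\<And>k. k \<in> K \<Longrightarrow> T k = k"
    have lin: "linear T" using T(1) by (rule orthogonal_transformation_linear)
    have Tu: "T u = u" "T o1 = o1" using T(2) by (auto simp: K_def)
    have shift: "q *\<^sub>R u + T (x - q *\<^sub>R u) = T x" for x
      by (simp add: linear_diff[OF lin] linear_scale[OF lin] Tu)
    have inner: "T x \<bullet> u = x \<bullet> u" "T x \<bullet> o1 = x \<bullet> o1" for x
      using T(1) Tu by (metis orthogonal_transformation_def)+
    have "T ` corr_affine u q = corr_affine u q"
    proof (intro equalityI subsetI)
      fix x assume x: "x \<in> corr_affine u q"
      obtain y where y: "x = T y" using orthogonal_transformation_bij[OF T(1)] by (metis bij_pointE)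
      then show "x \<in> T ` corr_affine u q" using x by (auto simp: affine inner)
    qed (auto simp: affine inner)
    then show "distr M borel T = M" using unif(3)[OF T(1)] by (simp add: shift)
  qed
  have pearson_sphere: "pearson x v = sqrt (1 - r\<^sup>2) * (q * r / sqrt (1 - r\<^sup>2) + x \<bullet> e)"
    if "x \<in> corr_sphere u q" for x
  proof -
    have "pearson x v = x \<bullet> v" using sphere[OF that] assms by (intro pearson_unit)
    also have "\<dots> = q * r + sqrt (1 - r\<^sup>2) * (x \<bullet> e)"
      using sphere[OF that] by (subst v) (simp add: inner_add_right)
    finally show ?thesis using r2 by (simp add: distrib_left)
  qed
  have prob: "\<P>(\<omega> in P. Q (pearson (U \<omega>) v)) = measure M {x. R (x \<bullet> e)}"
    if [measurable]: "Measurable.pred borel Q" "Measurable.pred borel R"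
      and QR: "\<And>x. x \<in> corr_sphere u q \<Longrightarrow> Q (pearson x v) \<longleftrightarrow> R (x \<bullet> e)" for Q R
  proof -
    have "\<P>(\<omega> in P. Q (pearson (U \<omega>) v)) = measure M {x. Q (pearson x v)}"
      unfolding M_def by (subst measure_distr) (auto simp: vimage_def intro!: arg_cong[where f = "measure P"])
    also have "\<dots> = measure M {x. R (x \<bullet> e)}"
      using AE_sphere by (intro M.finite_measure_eq_AE) (auto simp: QR elim: eventually_mono)
    finally show ?thesis .
  qed
  have pos: "\<P>(\<omega> in P. pearson (U \<omega>) v \<ge> 0) = 1 / 2 * measure M {x. c \<le> \<bar>x \<bullet> e\<bar>}" if "r < 0"
  proof -
    have "c = - (q * r / sqrt (1 - r\<^sup>2))"
      using that assms(2) by (simp add: c_def corr_ratio_def abs_mult)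
    then have "\<P>(\<omega> in P. pearson (U \<omega>) v \<ge> 0) = measure M {x. c \<le> x \<bullet> e}"
      using r2 by (intro prob) (auto simp: pearson_sphere zero_le_mult_iff)
    then show ?thesis using prob_inner_tail(1)[OF e eK c] by simp
  qed
  have neg: "\<P>(\<omega> in P. pearson (U \<omega>) v < 0) = 1 / 2 * measure M {x. c < \<bar>x \<bullet> e\<bar>}" if "r > 0"
  proof -
    have "c = q * r / sqrt (1 - r\<^sup>2)"
      using that assms(2) by (simp add: c_def corr_ratio_def abs_mult)
    then have "\<P>(\<omega> in P. pearson (U \<omega>) v < 0) = measure M {x. x \<bullet> e < - c}"
      using r2 by (intro prob) (auto simp: pearson_sphere mult_less_0_iff)
    then show ?thesis using prob_inner_tail(2)[OF e eK c] by simp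
  qed
  show ?thesis
  proof (cases "CARD('n) = 3")
    case True
    have AE_s: "AE x in M. \<bar>x \<bullet> e\<bar> = s"
      using e eK cardK True by (intro AE_abs_inner_eq_radius) auto
    have const: "measure M {x. R \<bar>x \<bullet> e\<bar>} = (if R s then 1 else 0)"
      if [measurable]: "Measurable.pred borel R" for R
    proof -
      have "measure M {x. R \<bar>x \<bullet> e\<bar>} = measure M {x. R s}"
        using AE_s by (intro M.finite_measure_eq_AE) (auto elim: eventually_mono)
      then show ?thesis using M.prob_space by simp
    qed
    have le: "c\<^sup>2 \<le> 1 - q\<^sup>2 \<longleftrightarrow> c \<le> s"
      using c q2 by (auto simp: s_def intro: real_le_rsqrt dest: power_mono[of c _ 2])
    have eq: "c = s \<longleftrightarrow> c\<^sup>2 = 1 - q\<^sup>2"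
      using c q2 real_sqrt_unique[of c "1 - q\<^sup>2"] by (auto simp: s_def)
    have h: "h CARD('n) q r = (if c \<le> s then 1 / 2 else 0)"
      by (simp add: h_def True le flip: c_def)
    show ?thesis
    proof (intro conjI impI)
      assume "r < 0"
      then show "\<P>(\<omega> in P. pearson (U \<omega>) v \<ge> 0) = h CARD('n) q r"
        by (simp add: pos const[of "\<lambda>t. c \<le> t"] h)
    next
      assume r: "r > 0 \<and> \<not> (CARD('n) = 3 \<and> (corr_ratio q r)\<^sup>2 = 1 - q\<^sup>2)"
      then have "c < s \<longleftrightarrow> c \<le> s" using True eq by (auto simp: c_def)
      then show "\<P>(\<omega> in P. pearson (U \<omega>) v < 0) = h CARD('n) q r"
        using r by (simp add: neg const[of "\<lambda>t. c < t"] h)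
    qed
  next
    case False
    then have dim: "DIM(real ^ 'n) = card K + 1 + (CARD('n) - 3)" "0 < CARD('n) - 3"
      using assms(1) cardK by auto
    have "s\<^sup>2 = 1 - q\<^sup>2" using q2 by (simp add: s_def)
    then show ?thesis
      using pos neg prob_abs_inner[OF e eK dim c] False by (simp add: h_def c_def[symmetric])
  qed
qed

end
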